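(* Let $E_1,E_2,\ldots$ be sequential e-values for $H_1,H_2,\ldots$, and let $(d_t^{(1)})_{t\in\mathbb{N}},(d_t^{(2)})_{t\in\mathbb{N}},\ldots$ be the bounds obtained by applying the \texttt{SeqE-Guard} algorithm (with these same e-values) to multiple query paths $(S_t^{(1)})_{t\in\mathbb{N}},(S_t^{(2)})_{t\in\mathbb{N}},\ldots$. Then for all $\mathbb{P}\in\mathcal{P}$, $$\mathbb{P}\big(d_t^{(m)}\le |S_t^{(m)}\cap I_1^{\mathbb{P}}|\ \text{ for all } t,m\in\mathbb{N}\big)\ge 1-\alpha.$$
   Context: Setting. $\mathbb{N}=\{1,2,\ldots\}$, $\alpha\in(0,1)$ is fixed, $\Omega$ is equipped with a filtration $(\mathcal{F}_i)_{i\in\mathbb{N}_0}$ with $\mathcal{F}_0=\{\emptyset,\Omega\}$, and $\mathcal{P}$ is a set of probability distributions. Null hypotheses are subsets $H_1,H_2,\ldots\subseteq\mathcal{P}$. For $\mathbb{P}\in\mathcal{P}$: $I_0^{\mathbb{P}}=\{i\in\mathbb{N}:\mathbb{P}\in H_i\}$, $I_1^{\mathbb{P}}=\mathbb{N}\setminus I_0^{\mathbb{P}}$. Sequential e-values for $H_1,H_2,\ldots$: nonnegative random variables $E_1,E_2,\ldots$ such that $E_t$ is $\mathcal{F}_t$-measurable and $\mathbb{E}_{\mathbb{P}}[E_t\mid\mathcal{F}_{t-1}]\le 1$ for all $\mathbb{P}\in H_t$, $t\in\mathbb{N}$. \texttt{SeqE-Guard} algorithm. Input: $E_1,E_2,\ldots$.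 Initialize $d_0=0$, $S_0=\emptyset$, $U=\emptyset$, $A=\emptyset$. For $t=1,2,\ldots$: set $d_t=d_{t-1}$; the statistician decides, (measurably) based on $E_1,\ldots,E_t$ and otherwise arbitrarily, whether $S_t=S_{t-1}\cup\{t\}$ or $S_t=S_{t-1}$. If $t\in S_t$: replace $A$ by $A\cup\{t\}$; then, if $\prod_{i\in A\cup U}E_i\ge 1/\alpha$, set $d_t=d_{t-1}+1$ and remove from $A$ the index of a largest e-value in $A$ (ties broken arbitrarily). If instead $t\notin S_t$ and $E_t<1$: replace $U$ by $U\cup\{t\}$. Output $(S_t,d_t)$. A query path is a sequence $(S_t)_{t\in\mathbb{N}}$ of sets of this form. *)

theory Defs
  imports "HOL-Probability.Probability"
begin

text \<open>
  Time points and hypotheses are indexed by the positive integers; index \<open>0\<close> occurs only as the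
  initial time, and the values \<open>H 0\<close> and \<open>E 0\<close> are never used.
\<close>

definition null_indices :: "(nat \<Rightarrow> 'a measure set) \<Rightarrow> 'a measure \<Rightarrow> nat set" where
  "null_indices H P = {i. 1 \<le> i \<and> P \<in> H i}"

definition nonnull_indices :: "(nat \<Rightarrow> 'a measure set) \<Rightarrow> 'a measure \<Rightarrow> nat set" where
  "nonnull_indices H P = {1..} - null_indices H P"

text \<open>
  The conditional expectation is the one for \<open>[0, \<infinity>]\<close>-valued functions, because integrability of
  \<open>E t\<close> is not assumed; \<^const>\<open>real_cond_exp\<close> would silently replace the value \<open>\<infinity>\<close> by \<open>0\<close>.
\<close>

definition sequential_e_values ::
  "'a set \<Rightarrow> (nat \<Rightarrow> 'a measure) \<Rightarrow> (nat \<Rightarrow> 'a measure set) \<Rightarrow> (nat \<Rightarrow> 'a \<Rightarrow> real) \<Rightarrow> bool" where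
  "sequential_e_values \<Omega> F H E \<longleftrightarrow>
     (\<forall>t\<ge>1. (\<forall>\<omega>\<in>\<Omega>. 0 \<le> E t \<omega>) \<and>
            E t \<in> borel_measurable (F t) \<and>
            (\<forall>P\<in>H t. AE \<omega> in P. nn_cond_exp P (F (t - 1)) (\<lambda>\<omega>. ennreal (E t \<omega>)) \<omega> \<le> 1))"

text \<open>
  The decision whether \<open>t\<close> is queried is measurable with respect to the sigma-algebra generated by
  \<open>E 1, \<dots>, E t\<close>, that is, it is a measurable function of the vector of these e-values.
\<close>

definition query_path :: "'a set \<Rightarrow> (nat \<Rightarrow> 'a \<Rightarrow> real) \<Rightarrow> (nat \<Rightarrow> 'a \<Rightarrow> nat set) \<Rightarrow> bool" where
  "query_path \<Omega> E S \<longleftrightarrow>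
     (\<forall>\<omega>\<in>\<Omega>. S 0 \<omega> = {}) \<and>
     (\<forall>t\<ge>1. (\<forall>\<omega>\<in>\<Omega>. S t \<omega> = S (t - 1) \<omega> \<union> {t} \<or> S t \<omega> = S (t - 1) \<omega>) \<and>
            Measurable.pred
              (vimage_algebra \<Omega> (\<lambda>\<omega>. \<lambda>i\<in>{1..t}. E i \<omega>) (\<Pi>\<^sub>M i\<in>{1..t}. borel))
              (\<lambda>\<omega>. t \<in> S t \<omega>))"

text \<open>
  One iteration of the algorithm on realised e-values \<open>e\<close>, leading from the variables \<open>(d, A, U)\<close>
  after time \<open>t - 1\<close> to \<open>(d', A', U')\<close> after time \<open>t\<close>. It is a relation rather than a function,
  since any index of a largest e-value may be the one that is removed.
\<close>

definition seqe_guard_step ::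
  "real \<Rightarrow> (nat \<Rightarrow> real) \<Rightarrow> nat \<Rightarrow> nat set \<Rightarrow>
   nat \<times> nat set \<times> nat set \<Rightarrow> nat \<times> nat set \<times> nat set \<Rightarrow> bool" where
  "seqe_guard_step \<alpha> e t St = (\<lambda>(d, A, U) (d', A', U').
     if t \<in> St then
       U' = U \<and>
       (if (\<Prod>i\<in>(A \<union> {t}) \<union> U. e i) \<ge> 1 / \<alpha>
        then d' = d + 1 \<and> (\<exists>j. is_arg_max e (\<lambda>i. i \<in> A \<union> {t}) j \<and> A' = (A \<union> {t}) - {j})
        else d' = d \<and> A' = A \<union> {t})
     else
       d' = d \<and> A' = A \<and> U' = (if e t < 1 then U \<union> {t} else U))"

text \<open>
  \<open>seqe_guard \<alpha> e S d\<close>: for some admissible tie-breaking, \<open>d\<close> is the sequence of bounds output by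
  the algorithm along the path \<open>S\<close>.
\<close>

definition seqe_guard ::
  "real \<Rightarrow> (nat \<Rightarrow> real) \<Rightarrow> (nat \<Rightarrow> nat set) \<Rightarrow> (nat \<Rightarrow> nat) \<Rightarrow> bool" where
  "seqe_guard \<alpha> e S d \<longleftrightarrow>
     (\<exists>A U. d 0 = 0 \<and> A 0 = {} \<and> U 0 = {} \<and>
        (\<forall>t\<ge>1. seqe_guard_step \<alpha> e t (S t) (d (t - 1), A (t - 1), U (t - 1)) (d t, A t, U t)))"

end

theory Submission
  imports Defs
begin

text \<open>
  Along the true nulls the running product of the e-values is a nonnegative supermartingale started
  at \<open>1\<close>, so outside an event of probability at most \<open>\<alpha>\<close> it never reaches \<open>1 / \<alpha>\<close>. That event does
  not involve any query path, and on its complement no path can fail: at a first failure time there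
  have been exactly as many removals as queried non-nulls, so the surviving queried e-values match up
  with larger ones of the queried nulls, while the unqueried e-values in \<open>U\<close> are all below \<open>1\<close> and
  \<open>U\<close> contains all unqueried nulls of that kind. Hence the product tested by the algorithm is a lower
  bound for the product over the nulls, which would be at least \<open>1 / \<alpha>\<close>.
\<close>

section \<open>Runs of the algorithm along a fixed set of queried times\<close>

lemma Int_atLeastAtMost_Suc:
  "T \<inter> {Suc 0..Suc t} = (if Suc t \<in> T then insert (Suc t) (T \<inter> {Suc 0..t}) else T \<inter> {Suc 0..t})"
  by (auto simp: le_Suc_eq)

text \<open>\<open>T\<close> is the set of all queried times. Step \<open>t\<close> only asks whether \<open>t\<close> is queried, so \<open>T\<close> can
  replace \<open>S t\<close>.\<close>

definition guard_run ::
  "real \<Rightarrow> (nat \<Rightarrow> real) \<Rightarrow> nat set \<Rightarrow> (nat \<Rightarrow> nat) \<Rightarrow> (nat \<Rightarrow> nat set) \<Rightarrow> (nat \<Rightarrow> nat set) \<Rightarrow> bool" where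
  "guard_run \<alpha> e T d A U \<longleftrightarrow> d 0 = 0 \<and> A 0 = {} \<and> U 0 = {} \<and>
     (\<forall>t. seqe_guard_step \<alpha> e (Suc t) T (d t, A t, U t) (d (Suc t), A (Suc t), U (Suc t)))"

text \<open>Index \<open>t\<close> can enter only at time \<open>t\<close>, and nothing ever leaves
  a path. So the single set of all indices queried on arrival determines every \<open>S t\<close> by
  truncation.\<close>

lemma query_path_eq:
  fixes S :: "nat \<Rightarrow> nat set"
  assumes S0: "S 0 = {}"
    and S: "\<And>t. 1 \<le> t \<Longrightarrow> S t = S (t - 1) \<union> {t} \<or> S t = S (t - 1)"
  shows "S t = {i. i \<in> S i} \<inter> {1..t}"
proof (induction t)
  case (Suc t)
  have "Suc t \<in> S (Suc t) \<longleftrightarrow> S (Suc t) = S t \<union> {Suc t}"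
    using S[of "Suc t"] Suc by auto
  then show ?case
    using S[of "Suc t"] Suc by (auto simp: Int_atLeastAtMost_Suc)
qed (simp add: S0)

lemma seqe_guard_imp_run:
  assumes "seqe_guard \<alpha> e S d" and S: "\<And>t. S t = T \<inter> {1..t}"
  obtains A U where "guard_run \<alpha> e T d A U"
proof -
  obtain A U where *: "d 0 = 0" "A 0 = {}" "U 0 = {}"
    "\<And>t. 1 \<le> t \<Longrightarrow> seqe_guard_step \<alpha> e t (S t) (d (t - 1), A (t - 1), U (t - 1)) (d t, A t, U t)"
    using assms unfolding seqe_guard_def by blast
  have "guard_run \<alpha> e T d A U"
    unfolding guard_run_def
  proof (intro conjI allI)
    fix t
    have "seqe_guard_step \<alpha> e (Suc t) (S (Suc t)) = seqe_guard_step \<alpha> e (Suc t) T"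
      by (simp add: seqe_guard_step_def S)
    then show "seqe_guard_step \<alpha> e (Suc t) T (d t, A t, U t) (d (Suc t), A (Suc t), U (Suc t))"
      using *(4)[of "Suc t"] by simp
  qed (use * in auto)
  then show ?thesis ..
qed

text \<open>The counting identity reflects that each query adds one index to \<open>A\<close> and
  each removal is paid for by one increment of \<open>d\<close>. Unlike \<open>A\<close>, the set
  \<open>U\<close> is determined by \<open>e\<close>, \<open>T\<close> and \<open>t\<close> alone,
  however ties are broken.\<close>

definition guard_inv ::
  "(nat \<Rightarrow> real) \<Rightarrow> nat set \<Rightarrow> nat \<Rightarrow> nat \<times> nat set \<times> nat set \<Rightarrow> bool" where
  "guard_inv e T t = (\<lambda>(d, A, U). A \<subseteq> T \<inter> {1..t} \<and> U = {i \<in> {1..t} - T. e i < 1} \<and>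
     d + card A = card (T \<inter> {1..t}))"

lemma guard_inv_step:
  assumes inv: "guard_inv e T t (d, A, U)"
    and step: "seqe_guard_step \<alpha> e (Suc t) T (d, A, U) (d', A', U')"
  shows "guard_inv e T (Suc t) (d', A', U')"
proof -
  have fin: "finite A"
    using inv by (auto simp: guard_inv_def intro: finite_subset)
  have new: "Suc t \<notin> A"
    using inv by (auto simp: guard_inv_def)
  have U': "U' = {i \<in> {1..Suc t} - T. e i < 1}"
    using inv step by (auto simp: guard_inv_def seqe_guard_step_def le_Suc_eq split: if_splits)
  show ?thesis
  proof (cases "Suc t \<in> T")
    case False
    then show ?thesis
      using inv step U' by (auto simp: guard_inv_def seqe_guard_step_def Int_atLeastAtMost_Suc)
  next
    case True
    have "d' + card A' = Suc (d + card A)" "A' \<subseteq> insert (Suc t) A"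
      using step True fin new
      by (auto simp: seqe_guard_step_def is_arg_max_def card_Diff_singleton card.insert_remove
          split: if_splits)
    then show ?thesis
      using inv U' True by (auto simp: guard_inv_def Int_atLeastAtMost_Suc)
  qed
qed

lemma guard_run_inv:
  assumes "guard_run \<alpha> e T d A U"
  shows "guard_inv e T t (d t, A t, U t)"
proof (induction t)
  case 0
  then show ?case
    using assms by (simp add: guard_run_def guard_inv_def)
next
  case (Suc t)
  then show ?case
    using assms guard_inv_step unfolding guard_run_def by blast
qed

section \<open>Combinatorics of a failing bound\<close>

text \<open>Exchange argument: since the removed e-values are largest ones, the surviving \<open>A t\<close> lies
  pointwise below the queried nulls as long as there were at least as many queried non-nulls as
  removals.\<close>

lemma guard_run_injection:
  assumes run: "guard_run \<alpha> e T d A U"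
    and "\<And>s. s \<le> t \<Longrightarrow> card (T \<inter> {1..s} \<inter> N) \<le> card (A s)"
  shows "\<exists>\<phi>. inj_on \<phi> (T \<inter> {1..t} \<inter> N) \<and> \<phi> ` (T \<inter> {1..t} \<inter> N) \<subseteq> A t \<and>
           (\<forall>i\<in>T \<inter> {1..t} \<inter> N. e (\<phi> i) \<le> e i)"
  using assms(2)
proof (induction t)
  case (Suc t)
  define B where "B s = T \<inter> {1..s} \<inter> N" for s
  obtain \<phi> where \<phi>: "inj_on \<phi> (B t)" "\<phi> ` B t \<subseteq> A t" "\<And>i. i \<in> B t \<Longrightarrow> e (\<phi> i) \<le> e i"
    using Suc by (auto simp: B_def)
  have step: "seqe_guard_step \<alpha> e (Suc t) T (d t, A t, U t) (d (Suc t), A (Suc t), U (Suc t))"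
    using run by (auto simp: guard_run_def)
  have inv: "guard_inv e T t (d t, A t, U t)"
    using run by (rule guard_run_inv)
  have fin: "finite (A t)"
    using inv by (auto simp: guard_inv_def intro: finite_subset)
  have new: "Suc t \<notin> A t" "Suc t \<notin> B t"
    using inv by (auto simp: guard_inv_def B_def)
  show ?case
  proof (cases "Suc t \<in> T")
    case False
    then have "B (Suc t) = B t" "A (Suc t) = A t"
      using step by (simp_all add: B_def Int_atLeastAtMost_Suc seqe_guard_step_def)
    then show ?thesis
      using \<phi> unfolding B_def[symmetric] by auto
  next
    case True
    define A' where "A' = insert (Suc t) (A t)"
    define \<psi> where "\<psi> = \<phi>(Suc t := Suc t)"
    have B: "B (Suc t) \<subseteq> insert (Suc t) (B t)"
      by (auto simp: B_def le_Suc_eq)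
    have "inj_on \<psi> (insert (Suc t) (B t))"
    proof -
      have "Suc t \<notin> \<phi> ` B t"
        using \<phi>(2) new(1) by (rule contra_subsetD)
      then show ?thesis
        unfolding inj_on_insert \<psi>_def using \<phi>(1) new(2) by (auto simp: inj_on_fun_updI)
    qed
    then have "inj_on \<psi> (B (Suc t))"
      using B by (rule inj_on_subset)
    moreover have "\<psi> i \<in> A' \<and> e (\<psi> i) \<le> e i" if "i \<in> B (Suc t)" for i
    proof (cases "i = Suc t")
      case False
      then have "i \<in> B t"
        using B that by blast
      then show ?thesis
        using \<phi>(2,3) False by (auto simp: \<psi>_def A'_def)
    qed (simp add: \<psi>_def A'_def)
    ultimately have \<psi>: "inj_on \<psi> (B (Suc t))" "\<psi> ` B (Suc t) \<subseteq> A'"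
      "\<And>i. i \<in> B (Suc t) \<Longrightarrow> e (\<psi> i) \<le> e i"
      by auto
    show ?thesis
    proof (cases "A (Suc t) = A'")
      case True
      then show ?thesis
        using \<psi> unfolding B_def[symmetric] by auto
    next
      case False
      then obtain j where j: "j \<in> A'" "\<And>i. i \<in> A' \<Longrightarrow> e i \<le> e j" "A (Suc t) = A' - {j}"
        using step \<open>Suc t \<in> T\<close>
        by (auto simp: seqe_guard_step_def A'_def is_arg_max_def not_less split: if_splits)
      \<comment> \<open>The cardinality hypothesis holds even after the removal, so before it
        \<open>\<psi>\<close> must miss some \<open>k\<close> in \<open>A'\<close>.\<close>
      have "card (\<psi> ` B (Suc t)) = card (B (Suc t))"
        by (rule card_image) fact
      also have "\<dots> \<le> card (A (Suc t))"
        using Suc.prems[of "Suc t"] by (simp add: B_def)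
      also have "\<dots> < card A'"
        unfolding j(3) using j(1) fin by (intro card_Diff1_less) (auto simp: A'_def)
      finally have "\<psi> ` B (Suc t) \<noteq> A'"
        by auto
      then obtain k where k: "k \<in> A'" "k \<notin> \<psi> ` B (Suc t)"
        using \<psi>(2) by blast
      \<comment> \<open>Whatever was matched with the removed \<open>j\<close> is rerouted to the
        spare \<open>k\<close>. The pointwise bound survives because \<open>j\<close> carries a
        largest e-value.\<close>
      define \<rho> where "\<rho> i = (if \<psi> i = j then k else \<psi> i)" for i
      have "inj_on \<rho> (B (Suc t))"
        using \<psi>(1) k(2) by (auto simp: \<rho>_def inj_on_def)
      moreover have "\<rho> ` B (Suc t) \<subseteq> A (Suc t)"
        using \<psi>(2) k by (auto simp: \<rho>_def j(3))
      moreover have "e (\<rho> i) \<le> e i" if "i \<in> B (Suc t)" for i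
        using \<psi>(3)[OF that] j(2)[OF k(1)] by (auto simp: \<rho>_def)
      ultimately show ?thesis
        unfolding B_def[symmetric] by blast
    qed
  qed
qed auto

text \<open>Purely deterministic: a failure of any run is traced to a threshold crossing of one
  product that depends only on \<open>e\<close> and \<open>N\<close>. The witness \<open>s\<close>
  is the first failure time.\<close>

lemma guard_run_failure:
  assumes run: "guard_run \<alpha> e T d A U"
    and nonneg: "\<And>i. 1 \<le> i \<Longrightarrow> 0 \<le> e i"
    and fail: "card (T \<inter> {1..t} - N) < d t"
  shows "\<exists>s. 1 / \<alpha> \<le> (\<Prod>i\<in>{1..s} \<inter> N. e i)"
proof -
  \<comment> \<open>With \<open>N\<close> read as the set of true nulls, \<open>B s\<close> and
    \<open>C s\<close> are the nulls and non-nulls queried up to time \<open>s\<close>.\<close>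
  define B where "B s = T \<inter> {1..s} \<inter> N" for s
  define C where "C s = T \<inter> {1..s} - N" for s
  note inv = guard_run_inv[OF run, unfolded guard_inv_def prod.case]
  have dA: "d s + card (A s) = card (B s) + card (C s)" for s
  proof -
    have "card (T \<inter> {1..s}) = card (B s) + card (C s)"
      unfolding B_def C_def by (subst card_Un_disjoint[symmetric]) (auto intro: arg_cong[where f=card])
    then show ?thesis
      using inv[of s] by auto
  qed
  define n where "n = (LEAST t. card (C t) < d t)"
  have n: "card (C n) < d n"
    unfolding n_def by (rule LeastI[of _ t]) (use fail in \<open>simp add: C_def\<close>)
  have before: "d s \<le> card (C s)" if "s < n" for s
    using not_less_Least[of s "\<lambda>t. card (C t) < d t"] that by (auto simp: n_def)
  obtain t where t: "n = Suc t"
    using n run by (cases n) (auto simp: guard_run_def)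
  have step: "seqe_guard_step \<alpha> e n T (d t, A t, U t) (d n, A n, U n)"
    using run by (auto simp: guard_run_def t)
  \<comment> \<open>As \<open>n\<close> is the first failure,
    \<open>d t \<le> card (C t) \<le> card (C n) < d n\<close>. Since \<open>d\<close> grows by at
    most one per step, the first two inequalities are equalities, and step \<open>n\<close> passed
    the threshold test.\<close>
  have "card (C t) \<le> card (C n)"
    by (rule card_mono) (auto simp: C_def t)
  then have dt: "d t < d n" "d t \<le> card (C t)"
    using before[of t] n by (auto simp: t)
  then have nT: "n \<in> T" and prod: "1 / \<alpha> \<le> (\<Prod>i\<in>(A t \<union> {n}) \<union> U t. e i)" and "d n = Suc (d t)"
    using step by (auto simp: seqe_guard_step_def split: if_splits)
  then have Cn: "card (C n) = d t" "card (C t) = d t"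
    using dt n \<open>card (C t) \<le> card (C n)\<close> by auto
  have nN: "n \<in> N"
  proof (rule ccontr)
    assume "n \<notin> N"
    then have "C n = insert n (C t)"
      using nT by (auto simp: C_def t le_Suc_eq)
    then show False
      using Cn by (auto simp: C_def t card_insert_if)
  qed
  have Bn: "B n = insert n (B t)" "n \<notin> B t"
    using nT nN by (auto simp: B_def t le_Suc_eq)
  obtain \<phi> where \<phi>: "inj_on \<phi> (B t)" "\<phi> ` B t \<subseteq> A t" "\<And>i. i \<in> B t \<Longrightarrow> e (\<phi> i) \<le> e i"
  proof -
    \<comment> \<open>By \<open>dA\<close>, this is the absence of failures before \<open>n\<close>,
      rewritten in terms of \<open>A\<close>.\<close>
    have "card (B s) \<le> card (A s)" if "s \<le> t" for s
      using dA[of s] before[of s] that by (auto simp: t)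
    from guard_run_injection[OF run this[unfolded B_def]] show ?thesis
      unfolding B_def[symmetric] using that by blast
  qed
  have finA: "finite (A t)"
    using inv[of t] by (auto intro: finite_subset)
  \<comment> \<open>Equality \<open>d t = card (C t)\<close> gives \<open>A t\<close> and
    \<open>B t\<close> the same size, so the injection is onto.\<close>
  have "\<phi> ` B t = A t"
    using finA \<phi>(1,2) dA[of t] Cn by (intro card_subset_eq) (auto simp: card_image)
  then have prodA: "prod e (A t) = (\<Prod>i\<in>B t. e (\<phi> i))"
    using \<phi>(1) by (metis (no_types, lifting) prod.reindex_cong)
  have At: "\<And>i. i \<in> A t \<Longrightarrow> 1 \<le> i" "A t \<subseteq> T"
    using inv[of t] by auto
  have "prod e (A t) \<le> prod e (B t)"
    unfolding prodA using \<phi> At nonneg by (intro prod_mono) auto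
  \<comment> \<open>Dropping the non-nulls from \<open>U t\<close> removes factors below 1. Adding
    the remaining unqueried nulls inserts factors of at least 1.\<close>
  moreover have "prod e (U t) \<le> prod e ({1..t} \<inter> N - T)"
  proof -
    define V where "V = {i \<in> {1..t} - T. e i < 1 \<and> i \<in> N}"
    define W where "W = {i \<in> {1..t} - T. e i < 1 \<and> i \<notin> N}"
    have "prod e (U t) = prod e W * prod e V"
      unfolding V_def W_def using inv[of t]
      by (subst prod.union_disjoint[symmetric]) (auto intro: prod.cong)
    also have "\<dots> \<le> 1 * prod e V"
      using nonneg by (intro mult_right_mono prod_le_1 prod_nonneg) (auto simp: V_def W_def)
    also have "\<dots> = prod e V"
      by simp
    also have "\<dots> \<le> prod e ({1..t} \<inter> N - T)"
      using nonneg by (intro prod_mono2) (auto simp: V_def)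
    finally show ?thesis .
  qed
  ultimately have "prod e (A t) * e n * prod e (U t) \<le> prod e (B t) * e n * prod e ({1..t} \<inter> N - T)"
    using nonneg At inv[of t] by (intro mult_mono mult_nonneg_nonneg prod_nonneg) (auto simp: B_def t)
  also have "prod e (A t) * e n * prod e (U t) = (\<Prod>i\<in>(A t \<union> {n}) \<union> U t. e i)"
  proof -
    have "n \<notin> A t" "finite (U t)" "(A t \<union> {n}) \<inter> U t = {}"
      using inv[of t] by (auto simp: t)
    then show ?thesis
      using finA by (simp add: prod.union_disjoint mult.commute)
  qed
  also have "prod e (B t) * e n = prod e (B n)"
    using Bn by (simp add: B_def mult.commute)
  also have "prod e (B n) * prod e ({1..t} \<inter> N - T) = (\<Prod>i\<in>{1..n} \<inter> N. e i)"
    using nT unfolding B_def t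
    by (subst prod.union_disjoint[symmetric]) (auto intro!: prod.cong simp: le_Suc_eq)
  finally show ?thesis
    using prod by (meson order_trans)
qed


section \<open>Measurability of the bounds under arbitrary tie-breaking\<close>

text \<open>The tie-breaking may depend non-measurably on the outcome, and then so does \<open>A\<close>. The set of
  reachable states, in contrast, is measurable, and it determines \<open>d\<close>.\<close>

primrec guard_reach ::
  "real \<Rightarrow> (nat \<Rightarrow> real) \<Rightarrow> nat set \<Rightarrow> nat \<Rightarrow> nat \<times> nat set \<times> nat set \<Rightarrow> bool" where
  "guard_reach \<alpha> e T 0 = (\<lambda>x. x = (0, {}, {}))"
| "guard_reach \<alpha> e T (Suc t) = (\<lambda>x. \<exists>y\<in>{..t} \<times> Pow {1..t} \<times> Pow {1..t}.
     guard_reach \<alpha> e T t y \<and> seqe_guard_step \<alpha> e (Suc t) T y x)"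

text \<open>Confines the states at time \<open>t\<close> to a finite set, so the bounded quantifier
  in \<open>guard_reach\<close> loses no run and yields only finite unions of events.\<close>

lemma guard_inv_bounded:
  assumes "guard_inv e T t (d, A, U)"
  shows "(d, A, U) \<in> {..t} \<times> Pow {1..t} \<times> Pow {1..t}"
proof -
  have "card (T \<inter> {1..t}) \<le> card {1..t}"
    by (intro card_mono) auto
  then show ?thesis
    using assms by (auto simp: guard_inv_def)
qed

lemma guard_run_reach:
  assumes run: "guard_run \<alpha> e T d A U"
  shows "guard_reach \<alpha> e T t (d t, A t, U t)"
proof (induction t)
  case (Suc t)
  moreover have "seqe_guard_step \<alpha> e (Suc t) T (d t, A t, U t) (d (Suc t), A (Suc t), U (Suc t))"
    using run by (simp add: guard_run_def)
  ultimately show ?case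
    using guard_inv_bounded[OF guard_run_inv[OF run]] unfolding guard_reach.simps by blast
qed (use run in \<open>simp add: guard_run_def\<close>)

lemma guard_reach_inv:
  "guard_reach \<alpha> e T t x \<Longrightarrow> guard_inv e T t x"
proof (induction t arbitrary: x)
  case (Suc t)
  then show ?case
    by (cases x) (auto intro: guard_inv_step)
qed (simp add: guard_inv_def)

text \<open>Different tie-breaking may give different sets \<open>A\<close>, but tied indices carry
  equal e-values, so the multiset of values in \<open>A\<close> is the same. Together with
  \<open>U\<close> it fixes the tested product, hence every increment of \<open>d\<close>.\<close>

lemma guard_reach_unique:
  assumes "guard_reach \<alpha> e T t (d, A, U)" "guard_reach \<alpha> e T t (d', A', U')"
  shows "d = d' \<and> image_mset e (mset_set A) = image_mset e (mset_set A')"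
  using assms
proof (induction t arbitrary: d A U d' A' U')
  case (Suc t)
  obtain d0 A0 U0 where x: "guard_reach \<alpha> e T t (d0, A0, U0)"
    and sx: "seqe_guard_step \<alpha> e (Suc t) T (d0, A0, U0) (d, A, U)"
    using Suc.prems(1) by auto
  obtain d1 A1 U1 where y: "guard_reach \<alpha> e T t (d1, A1, U1)"
    and sy: "seqe_guard_step \<alpha> e (Suc t) T (d1, A1, U1) (d', A', U')"
    using Suc.prems(2) by auto
  have IH: "d0 = d1" "image_mset e (mset_set A0) = image_mset e (mset_set A1)"
    using Suc.IH[OF x y] by auto
  note inv = guard_reach_inv[OF x, unfolded guard_inv_def prod.case]
    guard_reach_inv[OF y, unfolded guard_inv_def prod.case]
  have fin: "finite A0" "finite A1" "finite U0" "Suc t \<notin> A0" "Suc t \<notin> A1"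
    using inv by (auto intro: finite_subset)
  have U: "U0 = U1"
    using inv by simp
  show ?case
  proof (cases "Suc t \<in> T")
    case False
    then show ?thesis
      using sx sy IH by (simp add: seqe_guard_step_def)
  next
    case True
    define B0 where "B0 = A0 \<union> {Suc t}"
    define B1 where "B1 = A1 \<union> {Suc t}"
    note step0 = sx[unfolded seqe_guard_step_def prod.case if_P[OF True], folded B0_def]
    note step1 = sy[unfolded seqe_guard_step_def prod.case if_P[OF True], folded B1_def]
    have B: "image_mset e (mset_set B0) = image_mset e (mset_set B1)"
      using fin IH by (simp add: B0_def B1_def)
    have fB: "finite B0" "finite B1" "B0 \<inter> U0 = {}" "B1 \<inter> U0 = {}"
      using fin inv True by (auto simp: B0_def B1_def)
    have img: "e ` B0 = e ` B1"
      using arg_cong[OF B, of set_mset] fB by simp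
    have "prod e B0 = prod e B1"
      using arg_cong[OF B, of prod_mset] by (simp add: prod_unfold_prod_mset)
    then have "prod e (B0 \<union> U0) = prod e (B1 \<union> U0)"
      using fB fin by (simp add: prod.union_disjoint)
    then have iff: "1 / \<alpha> \<le> prod e (B0 \<union> U0) \<longleftrightarrow> 1 / \<alpha> \<le> prod e (B1 \<union> U1)"
      by (simp add: U)
    show ?thesis
    proof (cases "1 / \<alpha> \<le> prod e (B0 \<union> U0)")
      case False
      then show ?thesis
        using step0 step1 IH(1) iff B by simp
    next
      case pos: True
      obtain j where j: "is_arg_max e (\<lambda>i. i \<in> B0) j" "A = B0 - {j}" "d = d0 + 1"
        using step0 pos by auto
      obtain k where k: "is_arg_max e (\<lambda>i. i \<in> B1) k" "A' = B1 - {k}" "d' = d1 + 1"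
        using step1 pos[unfolded iff] by auto
      have in_B: "j \<in> B0" "k \<in> B1"
        using j k by (auto simp: is_arg_max_def)
      have max_B: "\<And>i. i \<in> B0 \<Longrightarrow> e i \<le> e j" "\<And>i. i \<in> B1 \<Longrightarrow> e i \<le> e k"
        using j(1) k(1) by (auto simp: is_arg_max_def not_less)
      have "e j \<in> e ` B1" "e k \<in> e ` B0"
        using in_B img by auto
      then have "e j \<le> e k" "e k \<le> e j"
        using max_B by auto
      then have "e j = e k"
        by simp
      have "image_mset e (mset_set A) = image_mset e (mset_set B0) - {#e j#}"
        using in_B fB by (simp add: j mset_set_Diff image_mset_Diff)
      also have "\<dots> = image_mset e (mset_set A')"
        using in_B fB by (simp add: k mset_set_Diff image_mset_Diff B \<open>e j = e k\<close>)
      finally show ?thesis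
        using j k IH by simp
    qed
  qed
qed auto

lemma measurable_guard_step:
  assumes E: "\<And>i. 1 \<le> i \<Longrightarrow> E i \<in> borel_measurable M"
    and T: "\<And>i. 1 \<le> i \<Longrightarrow> Measurable.pred M (\<lambda>\<omega>. i \<in> T \<omega>)"
    and AU: "A \<subseteq> {1..t}" "U \<subseteq> {1..t}"
  shows "Measurable.pred M (\<lambda>\<omega>. seqe_guard_step \<alpha> (\<lambda>i. E i \<omega>) (Suc t) (T \<omega>) (d, A, U) x)"
proof -
  obtain d' A' U' where x: "x = (d', A', U')"
    by (cases x) auto
  define B where "B = A \<union> {Suc t}"
  have B: "finite B" "\<And>i. i \<in> B \<Longrightarrow> E i \<in> borel_measurable M"
    using AU E by (auto simp: B_def intro: finite_subset)
  have BU: "\<And>i. i \<in> B \<union> U \<Longrightarrow> E i \<in> borel_measurable M"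
    using AU E by (auto simp: B_def)
  have [measurable]: "(\<lambda>\<omega>. \<Prod>i\<in>B \<union> U. E i \<omega>) \<in> borel_measurable M"
    using BU by (rule borel_measurable_prod)
  have [measurable]: "E (Suc t) \<in> borel_measurable M"
    using E by simp
  have [measurable]: "Measurable.pred M (\<lambda>\<omega>. Suc t \<in> T \<omega>)"
    using T by simp
  \<comment> \<open>The unbounded choice of \<open>j\<close> becomes one over the finite set
    \<open>B\<close>, to which the closure rules for finite quantifiers apply.\<close>
  have argmax: "(\<exists>j. is_arg_max e (\<lambda>i. i \<in> B) j \<and> A' = B - {j}) \<longleftrightarrow>
    (\<exists>j\<in>B. (\<forall>i\<in>B. e i \<le> e j) \<and> A' = B - {j})" for e :: "nat \<Rightarrow> real"
    by (auto simp: is_arg_max_def not_less)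
  have [measurable]: "Measurable.pred M (\<lambda>\<omega>. \<exists>j\<in>B. (\<forall>i\<in>B. E i \<omega> \<le> E j \<omega>) \<and> A' = B - {j})"
  proof (intro pred_intros_finite B(1) pred_intros_logic)
    fix i j assume "i \<in> B" "j \<in> B"
    then have [measurable]: "E i \<in> borel_measurable M" "E j \<in> borel_measurable M"
      by (auto intro: B)
    show "Measurable.pred M (\<lambda>\<omega>. E i \<omega> \<le> E j \<omega>)"
      by measurable
  qed auto
  show ?thesis
    unfolding x seqe_guard_step_def prod.case B_def[symmetric] argmax by measurable
qed

lemma measurable_guard_reach:
  assumes E: "\<And>i. 1 \<le> i \<Longrightarrow> E i \<in> borel_measurable M"
    and T: "\<And>i. 1 \<le> i \<Longrightarrow> Measurable.pred M (\<lambda>\<omega>. i \<in> T \<omega>)"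
  shows "Measurable.pred M (\<lambda>\<omega>. guard_reach \<alpha> (\<lambda>i. E i \<omega>) (T \<omega>) t x)"
proof (induction t arbitrary: x)
  case (Suc t)
  have "Measurable.pred M (\<lambda>\<omega>. seqe_guard_step \<alpha> (\<lambda>i. E i \<omega>) (Suc t) (T \<omega>) y x)"
    if "y \<in> {..t} \<times> Pow {1..t} \<times> Pow {1..t}" for y
    using that measurable_guard_step[OF E T] by (cases y) auto
  with Suc show ?case
    unfolding guard_reach.simps by (intro pred_intros_finite pred_intros_logic) auto
qed simp

text \<open>By uniqueness, \<open>d t\<close> takes the value \<open>k\<close> exactly when some
  state with first component \<open>k\<close> is reachable. This is a finite union of measurable
  events, although \<open>A\<close> and \<open>U\<close> are chosen separately for each
  outcome.\<close>

lemma measurable_guard_run: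
  assumes E: "\<And>i. 1 \<le> i \<Longrightarrow> E i \<in> borel_measurable M"
    and T: "\<And>i. 1 \<le> i \<Longrightarrow> Measurable.pred M (\<lambda>\<omega>. i \<in> T \<omega>)"
    and run: "\<And>\<omega>. \<omega> \<in> space M \<Longrightarrow> \<exists>A U. guard_run \<alpha> (\<lambda>i. E i \<omega>) (T \<omega>) (\<lambda>t. d t \<omega>) A U"
  shows "d t \<in> measurable M (count_space UNIV)"
proof -
  have "d t \<omega> = k \<longleftrightarrow>
      (\<exists>x\<in>{k} \<times> Pow {1..t} \<times> Pow {1..t}. guard_reach \<alpha> (\<lambda>i. E i \<omega>) (T \<omega>) t x)"
    if \<omega>: "\<omega> \<in> space M" for \<omega> k
  proof -
    obtain A U where AU: "guard_run \<alpha> (\<lambda>i. E i \<omega>) (T \<omega>) (\<lambda>t. d t \<omega>) A U"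
      using run[OF \<omega>] by blast
    show ?thesis
      using guard_run_reach[OF AU, of t] guard_inv_bounded[OF guard_run_inv[OF AU, of t]]
      by (force dest: guard_reach_unique)
  qed
  moreover have "Measurable.pred M (\<lambda>\<omega>. \<exists>x\<in>{k} \<times> Pow {1..t} \<times> Pow {1..t}.
      guard_reach \<alpha> (\<lambda>i. E i \<omega>) (T \<omega>) t x)" for k
    by (intro pred_intros_finite measurable_guard_reach E T) auto
  ultimately have "Measurable.pred M (\<lambda>\<omega>. d t \<omega> = k)" for k
    by (subst measurable_cong) auto
  then show ?thesis
    by (subst measurable_count_space_eq2_countable) (auto simp: pred_def vimage_def Int_def conj_commute)
qed

section \<open>Maximal inequality for the product over the nulls\<close>

text \<open>Ville's inequality. The supermartingale property is stated through integrals over events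
  of \<open>F n\<close>, with values in \<open>ennreal\<close>, so that no integrability has to be
  tracked.\<close>

lemma nn_supermartingale_maximal_inequality:
  fixes X :: "nat \<Rightarrow> 'a \<Rightarrow> ennreal"
  assumes F: "filtration (space M) F" and sub: "\<And>n. subalgebra M (F n)"
    and X: "\<And>n. X n \<in> borel_measurable (F n)"
    and super: "\<And>n B. B \<in> sets (F n) \<Longrightarrow>
      (\<integral>\<^sup>+\<omega>\<in>B. X (Suc n) \<omega> \<partial>M) \<le> (\<integral>\<^sup>+\<omega>\<in>B. X n \<omega> \<partial>M)"
  shows "c * emeasure M {\<omega> \<in> space M. \<exists>n. c \<le> X n \<omega>} \<le> (\<integral>\<^sup>+\<omega>. X 0 \<omega> \<partial>M)"
proof -
  interpret filtration "space M" F by (rule F)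
  \<comment> \<open>Level \<open>c\<close> is reached strictly before time \<open>n\<close>; thus
    \<open>C 0\<close> is empty and \<open>C (Suc n)\<close> already belongs to
    \<open>F n\<close>.\<close>
  define C where "C n = {\<omega> \<in> space M. \<exists>k\<in>{..<n}. c \<le> X k \<omega>}" for n
  have XF: "X k \<in> borel_measurable (F n)" if "k \<le> n" for k n
    using X[of k] sets_F_mono[OF that] space_F by (auto simp: measurable_def)
  have XM[measurable]: "X n \<in> borel_measurable M" for n
    by (rule measurable_from_subalg[OF sub X])
  have CF: "C (Suc n) \<in> sets (F n)" for n
  proof -
    have "Measurable.pred (F n) (\<lambda>\<omega>. \<exists>k\<in>{..<Suc n}. c \<le> X k \<omega>)"
    proof (intro pred_intros_finite)
      fix k assume "k \<in> {..<Suc n}"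
      then have [measurable]: "X k \<in> borel_measurable (F n)"
        by (intro XF) simp
      show "Measurable.pred (F n) (\<lambda>\<omega>. c \<le> X k \<omega>)"
        by measurable
    qed simp
    then show ?thesis
      by (simp add: pred_def space_F C_def)
  qed
  have [measurable]: "C n \<in> sets M" for n
    unfolding C_def by measurable
  \<comment> \<open>The left side is the expectation of the process frozen at value \<open>c\<close>
    once the level has been reached.\<close>
  have bound: "c * emeasure M (C n) + (\<integral>\<^sup>+\<omega>\<in>space M - C n. X n \<omega> \<partial>M) \<le> (\<integral>\<^sup>+\<omega>. X 0 \<omega> \<partial>M)" for n
  proof (induction n)
    case 0
    then show ?case
      by (auto simp: C_def intro!: nn_integral_mono split: split_indicator)
  next
    case (Suc n)
    define D where "D = C (Suc n) - C n"
    have [measurable]: "D \<in> sets M"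
      by (simp add: D_def)
    have CD: "C (Suc n) = C n \<union> D" "C n \<inter> D = {}"
      by (auto simp: D_def C_def)
    have C_Suc: "emeasure M (C (Suc n)) = emeasure M (C n) + emeasure M D"
      unfolding CD(1) by (rule plus_emeasure[symmetric]) (auto simp: CD)
    \<comment> \<open>The supermartingale property is applied on the complement of
      \<open>C (Suc n)\<close>, an event of \<open>F n\<close>.\<close>
    have "c * emeasure M (C (Suc n)) + (\<integral>\<^sup>+\<omega>\<in>space M - C (Suc n). X (Suc n) \<omega> \<partial>M) \<le>
        c * (emeasure M (C n) + emeasure M D) + (\<integral>\<^sup>+\<omega>\<in>space M - C (Suc n). X n \<omega> \<partial>M)"
      unfolding C_Suc by (intro add_left_mono super) (metis CF sets.compl_sets space_F)
    also have "c * (emeasure M (C n) + emeasure M D) + (\<integral>\<^sup>+\<omega>\<in>space M - C (Suc n). X n \<omega> \<partial>M) =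
        c * emeasure M (C n) + ((\<integral>\<^sup>+\<omega>. c * indicator D \<omega> \<partial>M) +
          (\<integral>\<^sup>+\<omega>\<in>space M - C (Suc n). X n \<omega> \<partial>M))"
      by (simp add: distrib_left nn_integral_cmult_indicator add.assoc)
    also have "\<dots> = c * emeasure M (C n) +
        (\<integral>\<^sup>+\<omega>. c * indicator D \<omega> + X n \<omega> * indicator (space M - C (Suc n)) \<omega> \<partial>M)"
      by (subst nn_integral_add) auto
    \<comment> \<open>On \<open>D\<close> the level is first reached at time \<open>n\<close>, so
      \<open>c \<le> X n\<close> there.\<close>
    also have "\<dots> \<le> c * emeasure M (C n) + (\<integral>\<^sup>+\<omega>\<in>space M - C n. X n \<omega> \<partial>M)"
      by (intro add_left_mono nn_integral_mono)
        (auto simp: D_def C_def less_Suc_eq split: split_indicator)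
    also have "\<dots> \<le> (\<integral>\<^sup>+\<omega>. X 0 \<omega> \<partial>M)"
      by (rule Suc)
    finally show ?case .
  qed
  have "incseq C"
    by (auto simp: C_def incseq_def)
  then have "(SUP n. emeasure M (C n)) = emeasure M (\<Union>n. C n)"
    by (intro SUP_emeasure_incseq) auto
  moreover have "(\<Union>n. C n) = {\<omega> \<in> space M. \<exists>n. c \<le> X n \<omega>}"
    by (auto simp: C_def)
  ultimately have "c * emeasure M {\<omega> \<in> space M. \<exists>n. c \<le> X n \<omega>} = (SUP n. c * emeasure M (C n))"
    by (simp flip: SUP_mult_left_ennreal)
  also have "\<dots> \<le> (\<integral>\<^sup>+\<omega>. X 0 \<omega> \<partial>M)"
    using bound by (intro SUP_least) (rule order_trans[OF add_increasing2], auto)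
  finally show ?thesis .
qed

text \<open>The running product over \<open>N\<close> is a supermartingale from 1: a factor in
  \<open>N\<close> has conditional mean at most 1, and other times leave the product
  unchanged.\<close>

lemma sequential_e_values_maximal_inequality:
  assumes P: "prob_space P" and F: "filtration (space P) F" and sub: "\<And>i. subalgebra P (F i)"
    and E: "sequential_e_values (space P) F H E" and N: "\<And>i. i \<in> N \<Longrightarrow> P \<in> H i"
    and \<alpha>: "0 < \<alpha>"
  shows "emeasure P {\<omega> \<in> space P. \<exists>t. 1 / \<alpha> \<le> (\<Prod>i\<in>{1..t} \<inter> N. E i \<omega>)} \<le> \<alpha>"
proof -
  interpret prob_space P by (rule P)
  interpret filtration "space P" F by (rule F)
  have nonneg: "0 \<le> E i \<omega>" if "1 \<le> i" "\<omega> \<in> space P" for i \<omega>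
    using E that by (auto simp: sequential_e_values_def)
  have EF: "E i \<in> borel_measurable (F i)" if "1 \<le> i" for i
    using E that by (auto simp: sequential_e_values_def)
  define W where "W t \<omega> = (\<Prod>i\<in>{1..t} \<inter> N. ennreal (E i \<omega>))" for t \<omega>
  have WF: "W t \<in> borel_measurable (F t)" for t
    unfolding W_def
  proof (intro borel_measurable_prod_ennreal)
    fix i assume "i \<in> {1..t} \<inter> N"
    then have [measurable]: "E i \<in> borel_measurable (F t)"
      using EF[of i] sets_F_mono[of i t] space_F by (auto simp: measurable_def)
    show "(\<lambda>\<omega>. ennreal (E i \<omega>)) \<in> borel_measurable (F t)"
      by measurable
  qed
  have super: "(\<integral>\<^sup>+\<omega>\<in>B. W (Suc t) \<omega> \<partial>P) \<le> (\<integral>\<^sup>+\<omega>\<in>B. W t \<omega> \<partial>P)" if B: "B \<in> sets (F t)" for t B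
  proof (cases "Suc t \<in> N")
    case False
    then have "{1..Suc t} \<inter> N = {1..t} \<inter> N"
      by (auto simp: le_Suc_eq)
    then show ?thesis
      by (simp add: W_def)
  next
    case True
    interpret finite_measure_subalgebra P "F t"
      by unfold_locales (rule sub)
    have "{1..Suc t} \<inter> N = insert (Suc t) ({1..t} \<inter> N)"
      using True by (auto simp: le_Suc_eq)
    then have W_Suc: "W (Suc t) \<omega> = W t \<omega> * ennreal (E (Suc t) \<omega>)" for \<omega>
      by (simp add: W_def mult.commute)
    have [measurable]: "E (Suc t) \<in> borel_measurable P"
      by (rule measurable_from_subalg[OF sub EF]) simp
    have [measurable]: "W t \<in> borel_measurable (F t)" "B \<in> sets (F t)"
      using WF B by auto
    have le1: "AE \<omega> in P. nn_cond_exp P (F t) (\<lambda>\<omega>. ennreal (E (Suc t) \<omega>)) \<omega> \<le> 1"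
      using E N[OF True] by (auto simp: sequential_e_values_def dest!: spec[of _ "Suc t"])
    \<comment> \<open>The factor \<open>W t\<close> times the indicator of \<open>B\<close> is
      measurable for \<open>F t\<close>, so \<open>E (Suc t)\<close> may be replaced by its
      conditional expectation.\<close>
    have "(\<integral>\<^sup>+\<omega>\<in>B. W (Suc t) \<omega> \<partial>P) = (\<integral>\<^sup>+\<omega>. (W t \<omega> * indicator B \<omega>) * ennreal (E (Suc t) \<omega>) \<partial>P)"
      by (simp add: W_Suc mult_ac)
    also have "\<dots> = (\<integral>\<^sup>+\<omega>. (W t \<omega> * indicator B \<omega>) *
        nn_cond_exp P (F t) (\<lambda>\<omega>. ennreal (E (Suc t) \<omega>)) \<omega> \<partial>P)"
      by (intro nn_cond_exp_intg[symmetric]) measurable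
    also have "\<dots> \<le> (\<integral>\<^sup>+\<omega>. (W t \<omega> * indicator B \<omega>) * 1 \<partial>P)"
      using le1 by (intro nn_integral_mono_AE) (auto elim!: eventually_mono intro: mult_left_mono simp del: mult_1_right)
    finally show ?thesis
      by simp
  qed
  have *: "1 / \<alpha> \<le> (\<Prod>i\<in>{1..t} \<inter> N. E i \<omega>) \<longleftrightarrow> ennreal (1 / \<alpha>) \<le> W t \<omega>" if "\<omega> \<in> space P" for t \<omega>
  proof -
    have "W t \<omega> = ennreal (\<Prod>i\<in>{1..t} \<inter> N. E i \<omega>)"
      unfolding W_def using nonneg that by (intro prod_ennreal) auto
    moreover have "0 \<le> (\<Prod>i\<in>{1..t} \<inter> N. E i \<omega>)"
      using nonneg that by (intro prod_nonneg) auto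
    ultimately show ?thesis
      by (simp add: ennreal_le_iff)
  qed
  have "ennreal (1 / \<alpha>) * emeasure P {\<omega> \<in> space P. \<exists>t. ennreal (1 / \<alpha>) \<le> W t \<omega>} \<le> (\<integral>\<^sup>+\<omega>. W 0 \<omega> \<partial>P)"
    by (rule nn_supermartingale_maximal_inequality[OF F sub WF super])
  also have "\<dots> = 1"
    by (simp add: W_def emeasure_space_1)
  finally have "ennreal \<alpha> * (ennreal (1 / \<alpha>) *
      emeasure P {\<omega> \<in> space P. \<exists>t. ennreal (1 / \<alpha>) \<le> W t \<omega>}) \<le> ennreal \<alpha> * 1"
    by (rule mult_left_mono) simp
  then show ?thesis
    using \<alpha> * by (simp add: mult.assoc[symmetric] ennreal_mult[symmetric] cong: conj_cong)
qed

section \<open>Simultaneous validity along all query paths\<close>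

theorem corollary3p2:
  fixes \<alpha> :: real
    and M :: "'a measure"
    and F :: "nat \<Rightarrow> 'a measure"
    and \<P> :: "'a measure set"
    and H :: "nat \<Rightarrow> 'a measure set"
    and E :: "nat \<Rightarrow> 'a \<Rightarrow> real"
    and S :: "nat \<Rightarrow> nat \<Rightarrow> 'a \<Rightarrow> nat set"
    and d :: "nat \<Rightarrow> nat \<Rightarrow> 'a \<Rightarrow> nat"
  assumes "0 < \<alpha>" and "\<alpha> < 1"
    and "filtration (space M) F"
    and "\<And>i. subalgebra M (F i)"
    and "sets (F 0) = {{}, space M}"
    and "\<And>P. P \<in> \<P> \<Longrightarrow> prob_space P \<and> sets P = sets M"
    and "\<And>i. 1 \<le> i \<Longrightarrow> H i \<subseteq> \<P>"
    and "sequential_e_values (space M) F H E"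
    and "\<And>m. 1 \<le> m \<Longrightarrow> query_path (space M) E (S m)"
    and "\<And>m \<omega>. 1 \<le> m \<Longrightarrow> \<omega> \<in> space M \<Longrightarrow>
           seqe_guard \<alpha> (\<lambda>i. E i \<omega>) (\<lambda>t. S m t \<omega>) (\<lambda>t. d m t \<omega>)"
  shows "\<forall>P\<in>\<P>. measure P {\<omega> \<in> space P. \<forall>t\<ge>1. \<forall>m\<ge>1.
           d m t \<omega> \<le> card (S m t \<omega> \<inter> nonnull_indices H P)} \<ge> 1 - \<alpha>"
proof
  fix P assume "P \<in> \<P>"
  then interpret prob_space P
    using assms(6) by blast
  have sets_P: "sets P = sets M"
    using assms(6) \<open>P \<in> \<P>\<close> by blast
  then have space_P: "space P = space M"
    by (rule sets_eq_imp_space_eq)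
  have sub: "subalgebra P (F i)" for i
    using assms(4)[of i] by (simp add: subalgebra_def sets_P space_P)
  have EP: "E i \<in> borel_measurable P" if "1 \<le> i" for i
    using assms(8) that by (intro measurable_from_subalg[OF sub]) (auto simp: sequential_e_values_def)
  define N where "N = null_indices H P"
  define T where "T m \<omega> = {i. i \<in> S m i \<omega>}" for m \<omega>
  have S_eq: "S m t \<omega> = T m \<omega> \<inter> {1..t}" if "1 \<le> m" "\<omega> \<in> space P" for m t \<omega>
    unfolding T_def using assms(9)[OF that(1)] that(2)
    by (intro query_path_eq) (auto simp: query_path_def space_P)
  have T: "Measurable.pred P (\<lambda>\<omega>. i \<in> T m \<omega>)" if "1 \<le> m" "1 \<le> i" for m i
  proof -
    let ?E = "\<lambda>\<omega>. \<lambda>j\<in>{1..i}. E j \<omega>"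
    have "?E \<in> measurable P (\<Pi>\<^sub>M j\<in>{1..i}. borel)"
      by (intro measurable_restrict EP) auto
    \<comment> \<open>Query decisions are measurable for the sigma-algebra generated by finitely
      many e-values, which is coarser than that of \<open>P\<close>.\<close>
    then have "subalgebra P (vimage_algebra (space P) ?E (\<Pi>\<^sub>M j\<in>{1..i}. borel))"
      by (simp only: subalgebra_def space_vimage_algebra measurable_iff_sets simp_thms)
    then show ?thesis
      using assms(9)[OF that(1)] that(2) unfolding T_def
      by (auto simp: query_path_def space_P intro: measurable_from_subalg)
  qed
  have run: "\<exists>A U. guard_run \<alpha> (\<lambda>i. E i \<omega>) (T m \<omega>) (\<lambda>t. d m t \<omega>) A U"
    if "1 \<le> m" "\<omega> \<in> space P" for m \<omega>
    using that assms(10) S_eq by (metis seqe_guard_imp_run space_P)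
  have nonnull: "S m t \<omega> \<inter> nonnull_indices H P = T m \<omega> \<inter> {1..t} - N"
    if "1 \<le> m" "\<omega> \<in> space P" for m t \<omega>
    using that by (auto simp: S_eq nonnull_indices_def N_def)
  define G where "G = {\<omega> \<in> space P. \<forall>t\<ge>1. \<forall>m\<ge>1.
    d m t \<omega> \<le> card (S m t \<omega> \<inter> nonnull_indices H P)}"
  define X where "X = {\<omega> \<in> space P. \<exists>t. 1 / \<alpha> \<le> (\<Prod>i\<in>{1..t} \<inter> N. E i \<omega>)}"
  \<comment> \<open>Measurability of \<open>G\<close> is essential: \<open>measure\<close> assigns 0
    to non-measurable sets, and monotonicity of \<open>prob\<close> requires it.\<close>
  have "Measurable.pred P (\<lambda>\<omega>. d m t \<omega> \<le> card (T m \<omega> \<inter> {1..t} - N))" if "1 \<le> m" for m t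
  proof -
    have d: "d m t \<in> measurable P (count_space UNIV)"
      using EP T[OF that] run[OF that] by (rule measurable_guard_run)
    have "{\<omega> \<in> space P. i \<in> T m \<omega> \<inter> {1..t} - N} \<in> sets P" for i
      using T[OF that, of i] by (cases "i \<in> {1..t} - N") (auto simp: pred_def)
    then have card: "(\<lambda>\<omega>. card (T m \<omega> \<inter> {1..t} - N)) \<in> measurable P (count_space UNIV)"
      by (rule measurable_card)
    show ?thesis
      by (rule measurable_compose_countable[OF measurable_compose[OF card] d]) simp
  qed
  then have "Measurable.pred P (\<lambda>\<omega>. \<forall>t\<in>{1..}. \<forall>m\<in>{1..}. d m t \<omega> \<le> card (T m \<omega> \<inter> {1..t} - N))"
    by (intro pred_intros_countable_bounded) auto
  moreover have "{\<omega> \<in> space P. \<forall>t\<in>{1..}. \<forall>m\<in>{1..}. d m t \<omega> \<le> card (T m \<omega> \<inter> {1..t} - N)} = G"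
    by (auto simp: G_def nonnull)
  ultimately have G: "G \<in> sets P"
    by (simp only: pred_def)
  \<comment> \<open>The event \<open>X\<close> does not depend on \<open>m\<close>, so covering all
    paths at once costs no further probability.\<close>
  have "space P - X \<subseteq> G"
  proof
    fix \<omega> assume "\<omega> \<in> space P - X"
    then have \<omega>: "\<omega> \<in> space P" "\<not> (\<exists>t. 1 / \<alpha> \<le> (\<Prod>i\<in>{1..t} \<inter> N. E i \<omega>))"
      by (auto simp: X_def)
    have "d m t \<omega> \<le> card (T m \<omega> \<inter> {1..t} - N)" if m: "1 \<le> m" for m t
    proof (rule ccontr)
      assume "\<not> ?thesis"
      moreover obtain A U where "guard_run \<alpha> (\<lambda>i. E i \<omega>) (T m \<omega>) (\<lambda>t. d m t \<omega>) A U"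
        using run[OF m \<omega>(1)] by blast
      moreover have "0 \<le> E i \<omega>" if "1 \<le> i" for i
        using assms(8) \<omega>(1) that by (auto simp: sequential_e_values_def space_P)
      ultimately show False
        using guard_run_failure[of \<alpha> "\<lambda>i. E i \<omega>" "T m \<omega>" "\<lambda>t. d m t \<omega>" A U t N] \<omega>(2) by auto
    qed
    then show "\<omega> \<in> G"
      using \<omega>(1) by (auto simp: G_def nonnull)
  qed
  have "X \<in> sets P"
  proof -
    have [measurable]: "(\<lambda>\<omega>. \<Prod>i\<in>{1..t} \<inter> N. E i \<omega>) \<in> borel_measurable P" for t
      by (intro borel_measurable_prod EP) auto
    show ?thesis
      unfolding X_def by measurable
  qed
  have "emeasure P X \<le> ennreal \<alpha>"
    unfolding X_def using assms(1,3,8) prob_space_axioms sub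
    by (intro sequential_e_values_maximal_inequality[where F=F and H=H])
      (auto simp: space_P N_def null_indices_def)
  then have "1 - \<alpha> \<le> 1 - prob X"
    using assms(1) by (simp add: emeasure_eq_measure)
  also have "\<dots> = prob (space P - X)"
    using \<open>X \<in> sets P\<close> by (rule prob_compl[symmetric])
  also have "\<dots> \<le> prob G"
    using \<open>space P - X \<subseteq> G\<close> G by (rule finite_measure_mono)
  finally show "1 - \<alpha> \<le> prob {\<omega> \<in> space P. \<forall>t\<ge>1. \<forall>m\<ge>1.
      d m t \<omega> \<le> card (S m t \<omega> \<inter> nonnull_indices H P)}"
    by (simp only: G_def)
qed

end
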